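(* Let $\alpha:I\to\mathbb{I}^3$ be an admissible curve (of class $C^3$) in the simply isotropic space, parametrized by isotropic arc-length, with isotropic curvature $\kappa$ and torsion $\tau$. A rotation minimizing frame $\{\mathbf t,\mathbf n_1,\mathbf n_2=\mathbf b\}$ along $\alpha$ satisfies $$\frac{\mathrm d}{\mathrm ds}\begin{pmatrix}\mathbf t\\ \mathbf n_1\\ \mathbf n_2\end{pmatrix}=\begin{pmatrix}0&\kappa_1&\kappa_2\\-\kappa_1&0&0\\0&0&0\end{pmatrix}\begin{pmatrix}\mathbf t\\ \mathbf n_1\\ \mathbf n_2\end{pmatrix},$$ where the natural curvatures are $\kappa_1=\kappa$ and $\kappa_2=\kappa\,\theta$, with $\theta(s)=\int_{s_0}^s\tau(x)\,\mathrm dx+\tau_0$ for a constant $\tau_0$.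
   Context: The simply isotropic space $\mathbb{I}^3$ is $\mathbb{R}^3$ with the degenerate inner product $\langle\mathbf u,\mathbf v\rangle_z=u_1v_1+u_2v_2$. Arc-length means $\langle\alpha',\alpha'\rangle_z=1$. $\alpha=(x,y,z)$ is admissible if $x'y''-x''y'\neq0$ everywhere. Isotropic Frenet frame: $\mathbf t=\alpha'$, $\kappa=\sqrt{\langle\mathbf t',\mathbf t'\rangle_z}>0$, $\mathbf n=\mathbf t'/\kappa$, $\mathbf b=(0,0,1)$; it satisfies $\mathbf t'=\kappa\mathbf n$, $\mathbf n'=-\kappa\mathbf t+\tau\mathbf b$, $\mathbf b'=0$, which defines the isotropic torsion $\tau$. A normal vector field $\mathbf v$ ($\langle\mathbf v,\mathbf t\rangle_z=0$) is rotation minimizing if $\mathbf v'$ is a multiple of $\mathbf t$. A rotation minimizing frame $\{\mathbf t,\mathbf n_1,\mathbf n_2=\mathbf b\}$ is one where $\mathbf n_1$ is a rotation minimizing normal field with $\langle\mathbf n_1,\mathbf n_1\rangle_z=1$ such that the frame has the same orientation as $\{\mathbf t,\mathbf n,\mathbf b\}$; equivalently $\mathbf n_1=\mathbf n-\theta\mathbf b$ with $\theta'=\tau$. *)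

theory Defs
  imports "HOL-Analysis.Analysis"
begin

text \<open>
  Curves are total functions on the reals of which only the values on a nondegenerate
  interval \<open>I\<close> matter.  All derivatives are taken within \<open>I\<close>, so that they are the usual
  ones if \<open>I\<close> is open and one-sided at those endpoints of \<open>I\<close> that belong to \<open>I\<close>.
\<close>

definition nondegenerate_interval :: "real set \<Rightarrow> bool" where
  "nondegenerate_interval I \<longleftrightarrow> is_interval I \<and> (\<exists>a\<in>I. \<exists>b\<in>I. a < b)"

definition vderiv :: "real set \<Rightarrow> (real \<Rightarrow> 'a::real_normed_vector) \<Rightarrow> real \<Rightarrow> 'a" where
  "vderiv I f s = vector_derivative f (at s within I)"

primrec Ck_on :: "nat \<Rightarrow> real set \<Rightarrow> (real \<Rightarrow> 'a::real_normed_vector) \<Rightarrow> bool" where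
  "Ck_on 0 I f \<longleftrightarrow> continuous_on I f"
| "Ck_on (Suc k) I f \<longleftrightarrow> f differentiable_on I \<and> Ck_on k I (vderiv I f)"

definition iso_inner :: "real^3 \<Rightarrow> real^3 \<Rightarrow> real" where
  "iso_inner u v = u $ 1 * v $ 1 + u $ 2 * v $ 2"

definition iso_arc_length_param :: "real set \<Rightarrow> (real \<Rightarrow> real^3) \<Rightarrow> bool" where
  "iso_arc_length_param I \<alpha> \<longleftrightarrow>
     (\<forall>s\<in>I. iso_inner (vderiv I \<alpha> s) (vderiv I \<alpha> s) = 1)"

definition iso_admissible :: "real set \<Rightarrow> (real \<Rightarrow> real^3) \<Rightarrow> bool" where
  "iso_admissible I \<alpha> \<longleftrightarrow>
     (\<forall>s\<in>I. vderiv I \<alpha> s $ 1 * vderiv I (vderiv I \<alpha>) s $ 2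
            - vderiv I (vderiv I \<alpha>) s $ 1 * vderiv I \<alpha> s $ 2 \<noteq> 0)"

definition iso_tangent :: "real set \<Rightarrow> (real \<Rightarrow> real^3) \<Rightarrow> real \<Rightarrow> real^3" where
  "iso_tangent I \<alpha> = vderiv I \<alpha>"

definition iso_curvature :: "real set \<Rightarrow> (real \<Rightarrow> real^3) \<Rightarrow> real \<Rightarrow> real" where
  "iso_curvature I \<alpha> s =
     sqrt (iso_inner (vderiv I (iso_tangent I \<alpha>) s) (vderiv I (iso_tangent I \<alpha>) s))"

definition iso_normal :: "real set \<Rightarrow> (real \<Rightarrow> real^3) \<Rightarrow> real \<Rightarrow> real^3" where
  "iso_normal I \<alpha> s = vderiv I (iso_tangent I \<alpha>) s /\<^sub>R iso_curvature I \<alpha> s"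

definition iso_binormal :: "real^3" where
  "iso_binormal = vector [0, 0, 1]"

text \<open>The torsion is the coefficient of \<open>b\<close> in the Frenet equation for \<open>n'\<close>.\<close>

definition iso_torsion :: "real set \<Rightarrow> (real \<Rightarrow> real^3) \<Rightarrow> real \<Rightarrow> real" where
  "iso_torsion I \<alpha> s =
     (THE \<tau>. vderiv I (iso_normal I \<alpha>) s
              = - iso_curvature I \<alpha> s *\<^sub>R iso_tangent I \<alpha> s + \<tau> *\<^sub>R iso_binormal)"

definition iso_normal_field ::
    "real set \<Rightarrow> (real \<Rightarrow> real^3) \<Rightarrow> (real \<Rightarrow> real^3) \<Rightarrow> bool" where
  "iso_normal_field I \<alpha> v \<longleftrightarrow> (\<forall>s\<in>I. iso_inner (v s) (iso_tangent I \<alpha> s) = 0)"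

definition rotation_minimizing ::
    "real set \<Rightarrow> (real \<Rightarrow> real^3) \<Rightarrow> (real \<Rightarrow> real^3) \<Rightarrow> bool" where
  "rotation_minimizing I \<alpha> v \<longleftrightarrow>
     iso_normal_field I \<alpha> v \<and> v differentiable_on I \<and>
     (\<forall>s\<in>I. \<exists>c. vderiv I v s = c *\<^sub>R iso_tangent I \<alpha> s)"

text \<open>A frame is encoded as the matrix whose rows are the frame vectors.\<close>

definition frame_matrix :: "real^3 \<Rightarrow> real^3 \<Rightarrow> real^3 \<Rightarrow> real^3^3" where
  "frame_matrix u v w = vector [u, v, w]"

definition same_orientation :: "real^3^3 \<Rightarrow> real^3^3 \<Rightarrow> bool" where
  "same_orientation F G \<longleftrightarrow> det F * det G > 0"

definition rotation_minimizing_frame ::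
    "real set \<Rightarrow> (real \<Rightarrow> real^3) \<Rightarrow> (real \<Rightarrow> real^3) \<Rightarrow> (real \<Rightarrow> real^3) \<Rightarrow> bool" where
  "rotation_minimizing_frame I \<alpha> n1 n2 \<longleftrightarrow>
     rotation_minimizing I \<alpha> n1 \<and>
     (\<forall>s\<in>I. iso_inner (n1 s) (n1 s) = 1) \<and>
     (\<forall>s\<in>I. n2 s = iso_binormal) \<and>
     (\<forall>s\<in>I. same_orientation
              (frame_matrix (iso_tangent I \<alpha> s) (n1 s) (n2 s))
              (frame_matrix (iso_tangent I \<alpha> s) (iso_normal I \<alpha> s) iso_binormal))"

definition natural_curvature_matrix :: "real \<Rightarrow> real \<Rightarrow> real^3^3" where
  "natural_curvature_matrix \<kappa>1 \<kappa>2 =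
     vector [vector [0, \<kappa>1, \<kappa>2],
             vector [- \<kappa>1, 0, 0],
             vector [0, 0, 0]]"

end

theory Submission
  imports Defs
begin

text \<open>
  The isotropic metric only sees the first two coordinates, and there the tangent and the
  principal normal form an orthonormal basis of the plane.  Differentiating the orthonormality
  relations therefore gives the planar part of the Frenet equations, and the torsion is
  whatever is left in the third coordinate (lemmas \<open>normal_derivative_planar\<close> and
  \<open>torsion_eq\<close>).

  A unit field normal to \<open>t\<close> agrees in the plane with \<open>n\<close> up to sign, and the orientation
  condition fixes the sign.  So an oriented unit normal field \<open>v\<close> has the form
  \<open>n - \<theta> b\<close>, where \<open>\<theta>\<close> is the difference of the third coordinates
  (lemma \<open>oriented_unit_normal\<close>).  If moreover \<open>v' = c t\<close>, comparison with
  \<open>n' = - \<kappa> t + \<tau> b\<close> in the plane forces \<open>c = - \<kappa>\<close>, and comparison in the third coordinate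
  then gives \<open>\<theta>' = \<tau>\<close>.  Since the curve is of class \<open>C\<^sup>3\<close>, the torsion is continuous, so \<open>\<theta>\<close>
  is its integral up to the constant \<open>\<theta> s0\<close>.  The remaining equation is
  \<open>t' = \<kappa> n = \<kappa> v + \<kappa> \<theta> b\<close>.
\<close>

section \<open>Derivatives within an interval\<close>

lemma nondegenerate_interval_at_within_neq_bot:
  assumes "nondegenerate_interval I" "s \<in> I"
  shows "at s within I \<noteq> bot"
proof -
  have "connected I" "\<And>a. I \<noteq> {a}"
    using assms by (auto simp: nondegenerate_interval_def is_interval_connected_1)
  then show ?thesis
    using assms(2) connected_imp_perfect by (auto simp: trivial_limit_within)
qed

lemma vderiv_works:
  assumes "f differentiable_on I" "s \<in> I"
  shows "(f has_vector_derivative vderiv I f s) (at s within I)"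
  using assms unfolding differentiable_on_def vderiv_def
  by (simp add: vector_derivative_works)

lemma vderiv_eqI:
  assumes "nondegenerate_interval I" "s \<in> I"
    and "(f has_vector_derivative f') (at s within I)"
  shows "vderiv I f s = f'"
  unfolding vderiv_def
  by (intro vector_derivative_within nondegenerate_interval_at_within_neq_bot assms)

lemma has_vector_derivative_cong_on:
  assumes "(f has_vector_derivative f') (at s within I)"
    and "\<And>r. r \<in> I \<Longrightarrow> f r = g r" "s \<in> I"
  shows "(g has_vector_derivative f') (at s within I)"
  by (rule has_vector_derivative_transform[OF \<open>s \<in> I\<close> _ assms(1)]) (simp add: assms(2))

section \<open>The isotropic inner product\<close>

lemma bounded_bilinear_iso_inner: "bounded_bilinear iso_inner"
proof
  show "\<exists>K. \<forall>a b. norm (iso_inner a b) \<le> norm a * norm b * K"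
  proof (intro exI allI)
    fix a b :: "real^3"
    have "\<bar>a $ i * b $ i\<bar> \<le> norm a * norm b" for i
      unfolding abs_mult by (intro mult_mono component_le_norm_cart) auto
    then show "norm (iso_inner a b) \<le> norm a * norm b * 2"
      unfolding iso_inner_def real_norm_def
      by (smt (verit) abs_triangle_ineq)
  qed
qed (auto simp: iso_inner_def algebra_simps)

lemmas iso_inner_has_vector_derivative =
  bounded_bilinear.has_vector_derivative[OF bounded_bilinear_iso_inner]

lemma iso_inner_commute: "iso_inner u v = iso_inner v u"
  by (simp add: iso_inner_def mult.commute)

lemma iso_inner_scaleR [simp]:
  "iso_inner (c *\<^sub>R u) v = c * iso_inner u v" "iso_inner u (c *\<^sub>R v) = c * iso_inner u v"
  by (simp_all add: iso_inner_def algebra_simps)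

text \<open>Isotropically orthonormal pairs are orthonormal bases of the horizontal plane; the
  vertical coordinate of \<open>v\<close> is invisible to the metric, so only the first two coordinates
  are recovered.\<close>

lemma iso_orthonormal_expansion:
  assumes "iso_inner t t = 1" "iso_inner n n = 1" "iso_inner n t = 0"
  shows "v $ 1 = iso_inner v t * t $ 1 + iso_inner v n * n $ 1"
    and "v $ 2 = iso_inner v t * t $ 2 + iso_inner v n * n $ 2"
proof -
  define a b p q where abpq: "a = t $ 1" "b = t $ 2" "p = n $ 1" "q = n $ 2"
  define d where "d = a * q - b * p"
  have t: "a * a + b * b = 1" and n: "p * p + q * q = 1" and tn: "p * a + q * b = 0"
    using assms by (simp_all add: iso_inner_def abpq)
  have "p + d * b = a * (p * a + q * b) + p * (1 - (a * a + b * b))"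
    "q - d * a = b * (p * a + q * b) + q * (1 - (a * a + b * b))"
    unfolding d_def by (simp_all add: algebra_simps)
  then have pq: "p = - d * b" "q = d * a"
    unfolding t tn by simp_all
  have "(a * a + b * b) * (p * p + q * q) = d * d + (p * a + q * b) * (p * a + q * b)"
    unfolding d_def by (simp add: algebra_simps)
  then have d: "d * d = 1"
    unfolding t n tn by simp
  \<comment> \<open>A square matrix with orthonormal rows has orthonormal columns.\<close>
  have "a * a + p * p = a * a + (d * d) * (b * b)" "b * b + q * q = b * b + (d * d) * (a * a)"
    "a * b + p * q = a * b - (d * d) * (a * b)"
    unfolding pq by (simp_all add: algebra_simps)
  then have columns: "a * a + p * p = 1" "b * b + q * q = 1" "a * b + p * q = 0"
    unfolding d using t by simp_all
  have "iso_inner v t * a + iso_inner v n * p = v $ 1 * (a * a + p * p) + v $ 2 * (a * b + p * q)"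
    "iso_inner v t * b + iso_inner v n * q = v $ 1 * (a * b + p * q) + v $ 2 * (b * b + q * q)"
    unfolding iso_inner_def abpq by (simp_all add: algebra_simps)
  then show "v $ 1 = iso_inner v t * t $ 1 + iso_inner v n * n $ 1"
    and "v $ 2 = iso_inner v t * t $ 2 + iso_inner v n * n $ 2"
    unfolding columns by (simp_all add: abpq)
qed

lemma det_frame_matrix_binormal:
  "det (frame_matrix t v iso_binormal) = t $ 1 * v $ 2 - t $ 2 * v $ 1"
  by (simp add: frame_matrix_def iso_binormal_def det_3)

lemma iso_binormal_nth [simp]:
  "iso_binormal $ 1 = 0" "iso_binormal $ 2 = 0" "iso_binormal $ 3 = 1"
  by (simp_all add: iso_binormal_def)

text \<open>An isotropic unit normal is determined in the plane up to sign, and the sign is read off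
  from the orientation.\<close>

lemma oriented_unit_normal:
  assumes t: "iso_inner t t = 1" and n: "iso_inner n n = 1" "iso_inner n t = 0"
    and v: "iso_inner v v = 1" "iso_inner v t = 0"
    and orient: "same_orientation (frame_matrix t v iso_binormal) (frame_matrix t n iso_binormal)"
  shows "v = n - (n $ 3 - v $ 3) *\<^sub>R iso_binormal"
proof -
  define c where "c = iso_inner v n"
  have planar: "v $ 1 = c * n $ 1" "v $ 2 = c * n $ 2"
    using iso_orthonormal_expansion[OF t n, of v] v by (simp_all add: c_def)
  have "iso_inner v v = c * c * iso_inner n n"
    unfolding iso_inner_def planar by (simp add: algebra_simps)
  then have "c * c = 1"
    using v(1) n(1) by simp
  \<comment> \<open>The determinants of the two frames differ by the factor \<open>c\<close>.\<close>
  moreover have "c * (t $ 1 * n $ 2 - t $ 2 * n $ 1)\<^sup>2 > 0"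
    using orient unfolding same_orientation_def det_frame_matrix_binormal planar
    by (simp add: algebra_simps power2_eq_square)
  then have "c > 0"
    by (simp add: zero_less_mult_iff)
  ultimately have "c = 1"
    by (simp add: square_eq_1_iff)
  then show ?thesis
    using planar by (simp add: vec_eq_iff forall_3)
qed

section \<open>The isotropic Frenet frame\<close>

locale iso_curve =
  fixes I :: "real set" and \<alpha> :: "real \<Rightarrow> real^3"
  assumes interval: "nondegenerate_interval I"
    and C3: "Ck_on 3 I \<alpha>"
    and admissible: "iso_admissible I \<alpha>"
    and arc_length: "iso_arc_length_param I \<alpha>"
begin

abbreviation "T \<equiv> iso_tangent I \<alpha>"
abbreviation "T' \<equiv> vderiv I T"
abbreviation "T'' \<equiv> vderiv I T'"
abbreviation "\<kappa> \<equiv> iso_curvature I \<alpha>"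
abbreviation "N \<equiv> iso_normal I \<alpha>"
abbreviation "N' \<equiv> vderiv I N"

lemma tangent_has_derivative:
  assumes "s \<in> I"
  shows "(T has_vector_derivative T' s) (at s within I)"
    and "(T' has_vector_derivative T'' s) (at s within I)"
  using C3 assms by (auto simp: numeral_3_eq_3 iso_tangent_def intro: vderiv_works)

lemma continuous_on_tangent:
  shows "continuous_on I T" "continuous_on I T'" "continuous_on I T''"
  using C3 by (auto simp: numeral_3_eq_3 iso_tangent_def differentiable_imp_continuous_on)

lemma tangent_unit: "s \<in> I \<Longrightarrow> iso_inner (T s) (T s) = 1"
  using arc_length by (simp add: iso_arc_length_param_def iso_tangent_def)

text \<open>Arc-length parametrization makes \<open>\<langle>t, t\<rangle>\<close> constant, so its derivative vanishes.\<close>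

lemma tangent_derivative_orthogonal:
  assumes "s \<in> I"
  shows "iso_inner (T' s) (T s) = 0"
proof -
  have "((\<lambda>r. iso_inner (T r) (T r)) has_vector_derivative
          iso_inner (T s) (T' s) + iso_inner (T' s) (T s)) (at s within I)"
    by (intro iso_inner_has_vector_derivative tangent_has_derivative assms)
  then have "((\<lambda>r. 1::real) has_vector_derivative
          iso_inner (T s) (T' s) + iso_inner (T' s) (T s)) (at s within I)"
    by (rule has_vector_derivative_cong_on) (use tangent_unit assms in auto)
  then have "vderiv I (\<lambda>r. 1::real) s = iso_inner (T s) (T' s) + iso_inner (T' s) (T s)"
    by (rule vderiv_eqI[OF interval assms])
  moreover have "vderiv I (\<lambda>r. 1::real) s = 0"
    by (rule vderiv_eqI[OF interval assms]) simp
  ultimately show ?thesis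
    by (simp add: iso_inner_commute)
qed

text \<open>Admissibility excludes a vertical \<open>t'\<close>.\<close>

lemma tangent_derivative_pos:
  assumes "s \<in> I"
  shows "iso_inner (T' s) (T' s) > 0"
proof -
  have "T' s $ 1 \<noteq> 0 \<or> T' s $ 2 \<noteq> 0"
    using admissible assms by (auto simp: iso_admissible_def iso_tangent_def)
  then show ?thesis
    by (auto simp: iso_inner_def sum_squares_gt_zero_iff)
qed

lemma curvature_pos: "s \<in> I \<Longrightarrow> \<kappa> s > 0"
  using tangent_derivative_pos by (simp add: iso_curvature_def)

lemma curvature_squared: "s \<in> I \<Longrightarrow> \<kappa> s * \<kappa> s = iso_inner (T' s) (T' s)"
  using tangent_derivative_pos[of s] by (simp add: iso_curvature_def)

lemma frenet_tangent: "s \<in> I \<Longrightarrow> T' s = \<kappa> s *\<^sub>R N s"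
  using curvature_pos[of s] by (simp add: iso_normal_def)

lemma normal_unit: "s \<in> I \<Longrightarrow> iso_inner (N s) (N s) = 1"
  using curvature_pos[of s] curvature_squared[of s, symmetric]
  by (simp add: iso_normal_def field_simps)

lemma normal_orthogonal: "s \<in> I \<Longrightarrow> iso_inner (N s) (T s) = 0"
  using tangent_derivative_orthogonal[of s] by (simp add: iso_normal_def)

lemma curvature_has_derivative:
  assumes "s \<in> I"
  shows "(\<kappa> has_vector_derivative iso_inner (T' s) (T'' s) / \<kappa> s) (at s within I)"
proof -
  have "((\<lambda>r. iso_inner (T' r) (T' r)) has_vector_derivative
          iso_inner (T' s) (T'' s) + iso_inner (T'' s) (T' s)) (at s within I)"
    by (intro iso_inner_has_vector_derivative tangent_has_derivative assms)
  then have "((\<lambda>r. iso_inner (T' r) (T' r)) has_real_derivative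
          2 * iso_inner (T' s) (T'' s)) (at s within I)"
    by (simp add: has_real_derivative_iff_has_vector_derivative iso_inner_commute)
  from DERIV_chain2[where f = sqrt, OF DERIV_real_sqrt[OF tangent_derivative_pos[OF assms]] this]
  show ?thesis
    unfolding has_real_derivative_iff_has_vector_derivative[symmetric]
      iso_curvature_def[abs_def]
    by (simp add: field_simps)
qed

lemma continuous_on_curvature: "continuous_on I \<kappa>"
  unfolding iso_curvature_def
  by (intro continuous_intros bounded_bilinear.continuous_on[OF bounded_bilinear_iso_inner]
      continuous_on_tangent)

text \<open>An explicit formula for \<open>n'\<close> in terms of \<open>t'\<close> and \<open>t''\<close> makes its continuity visible, which
  the fundamental theorem of calculus later needs.\<close>

lemma normal_has_derivative:
  assumes "s \<in> I"
  shows "(N has_vector_derivative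
      T'' s /\<^sub>R \<kappa> s - (iso_inner (T' s) (T'' s) / (\<kappa> s) ^ 3) *\<^sub>R T' s) (at s within I)"
proof -
  have \<kappa>: "\<kappa> s > 0" using curvature_pos assms .
  have "((\<lambda>r. inverse (\<kappa> r)) has_real_derivative
      - (inverse (\<kappa> s) * (iso_inner (T' s) (T'' s) / \<kappa> s) * inverse (\<kappa> s))) (at s within I)"
    using curvature_has_derivative[OF assms] \<kappa>
    unfolding has_real_derivative_iff_has_vector_derivative[symmetric]
    by (intro DERIV_inverse') auto
  from has_vector_derivative_scaleR[OF this tangent_has_derivative(2)[OF assms]] \<kappa>
  show ?thesis
    unfolding iso_normal_def[abs_def]
    by (simp add: field_simps power3_eq_cube)
qed

lemma normal_has_vderiv: "s \<in> I \<Longrightarrow> (N has_vector_derivative N' s) (at s within I)"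
  using normal_has_derivative vderiv_eqI[OF interval _ normal_has_derivative] by simp

lemma continuous_on_normal_derivative: "continuous_on I N'"
proof -
  have "continuous_on I
      (\<lambda>s. T'' s /\<^sub>R \<kappa> s - (iso_inner (T' s) (T'' s) / (\<kappa> s) ^ 3) *\<^sub>R T' s)"
    using curvature_pos
    by (intro continuous_intros continuous_on_tangent continuous_on_curvature
        bounded_bilinear.continuous_on[OF bounded_bilinear_iso_inner]) force+
  then show ?thesis
    by (rule continuous_on_cong[THEN iffD1, rotated -1])
      (use vderiv_eqI[OF interval _ normal_has_derivative] in auto)
qed

text \<open>Differentiating \<open>\<langle>n, n\<rangle> = 1\<close> and \<open>\<langle>n, t\<rangle> = 0\<close> gives the coefficients of
  \<open>n'\<close> in the planar orthonormal basis \<open>t, n\<close>.\<close>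

lemma normal_derivative_planar:
  assumes "s \<in> I"
  shows "N' s $ 1 = - \<kappa> s * T s $ 1" "N' s $ 2 = - \<kappa> s * T s $ 2"
proof -
  have zero: "vderiv I (\<lambda>r. c::real) s = 0" for c
    by (rule vderiv_eqI[OF interval assms]) simp
  have "((\<lambda>r. iso_inner (N r) (N r)) has_vector_derivative
          iso_inner (N s) (N' s) + iso_inner (N' s) (N s)) (at s within I)"
    by (intro iso_inner_has_vector_derivative normal_has_vderiv assms)
  then have "((\<lambda>r. 1::real) has_vector_derivative
          iso_inner (N s) (N' s) + iso_inner (N' s) (N s)) (at s within I)"
    by (rule has_vector_derivative_cong_on) (use normal_unit assms in auto)
  from vderiv_eqI[OF interval assms this] have nn: "iso_inner (N' s) (N s) = 0"
    by (simp add: zero iso_inner_commute)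
  have "((\<lambda>r. iso_inner (N r) (T r)) has_vector_derivative
          iso_inner (N s) (T' s) + iso_inner (N' s) (T s)) (at s within I)"
    by (intro iso_inner_has_vector_derivative normal_has_vderiv tangent_has_derivative assms)
  then have "((\<lambda>r. 0::real) has_vector_derivative
          iso_inner (N s) (T' s) + iso_inner (N' s) (T s)) (at s within I)"
    by (rule has_vector_derivative_cong_on) (use normal_orthogonal assms in auto)
  from vderiv_eqI[OF interval assms this] have nt: "iso_inner (N' s) (T s) = - \<kappa> s"
    by (simp add: zero frenet_tangent[OF assms] normal_unit[OF assms])
  show "N' s $ 1 = - \<kappa> s * T s $ 1" "N' s $ 2 = - \<kappa> s * T s $ 2"
    using iso_orthonormal_expansion[OF tangent_unit normal_unit normal_orthogonal,
        OF assms assms assms, of "N' s"] nn nt by simp_all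
qed

text \<open>The planar part of \<open>n'\<close> being that of \<open>- \<kappa> t\<close>, the Frenet equation for \<open>n'\<close> reduces to its
  third coordinate, which has exactly one solution \<open>\<tau>\<close>; so the definite description denotes.\<close>

lemma torsion_eq:
  assumes "s \<in> I"
  shows "iso_torsion I \<alpha> s = N' s $ 3 + \<kappa> s * T s $ 3"
  unfolding iso_torsion_def
  by (rule the_equality) (simp_all add: vec_eq_iff forall_3 normal_derivative_planar[OF assms])

lemma continuous_on_torsion: "continuous_on I (iso_torsion I \<alpha>)"
proof -
  have "continuous_on I (\<lambda>s. N' s $ 3 + \<kappa> s * T s $ 3)"
    by (intro continuous_intros continuous_on_normal_derivative continuous_on_curvature
        continuous_on_tangent)
  then show ?thesis
    by (simp cong: continuous_on_cong_simp add: torsion_eq)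
qed

lemma integral_torsion:
  assumes "\<And>r. r \<in> I \<Longrightarrow> (\<theta> has_vector_derivative iso_torsion I \<alpha> r) (at r within I)"
    and "s0 \<in> I" "s \<in> I"
  shows "(LBINT x=ereal s0..ereal s. iso_torsion I \<alpha> x) = \<theta> s - \<theta> s0"
proof (rule interval_integral_FTC_finite)
  have sub: "{min s0 s..max s0 s} \<subseteq> I"
  proof
    fix r assume "r \<in> {min s0 s..max s0 s}"
    moreover have "min s0 s \<in> I" "max s0 s \<in> I"
      using assms(2,3) by (simp_all add: min_def max_def)
    ultimately show "r \<in> I"
      using interval unfolding nondegenerate_interval_def
      by (meson mem_is_interval_1_I atLeastAtMost_iff)
  qed
  show "continuous_on {min s0 s..max s0 s} (iso_torsion I \<alpha>)"
    using continuous_on_torsion sub by (rule continuous_on_subset)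
  show "(\<theta> has_vector_derivative iso_torsion I \<alpha> r) (at r within {min s0 s..max s0 s})"
    if "min s0 s \<le> r" "r \<le> max s0 s" for r
    by (rule has_vector_derivative_within_subset[OF assms(1) sub]) (use that sub in auto)
qed

section \<open>Rotation minimizing frames\<close>

context
  fixes v b :: "real \<Rightarrow> real^3"
  assumes frame: "rotation_minimizing_frame I \<alpha> v b"
begin

text \<open>An isotropic rotation of the normal plane, fixing \<open>b\<close>, is a vertical shear, so the angle
  from \<open>v\<close> to \<open>n\<close> is a difference of heights.\<close>

definition frame_angle :: "real \<Rightarrow> real" where
  "frame_angle s = N s $ 3 - v s $ 3"

lemma rotation_minimizing_normal_eq:
  assumes "s \<in> I"
  shows "v s = N s - frame_angle s *\<^sub>R iso_binormal"
  unfolding frame_angle_def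
  using frame assms tangent_unit[OF assms] normal_unit[OF assms] normal_orthogonal[OF assms]
  by (intro oriented_unit_normal[where t = "T s"])
    (auto simp: rotation_minimizing_frame_def rotation_minimizing_def iso_normal_field_def)

lemma binormal_const: "s \<in> I \<Longrightarrow> b s = iso_binormal"
  using frame by (simp add: rotation_minimizing_frame_def)

text \<open>The derivative of \<open>v\<close> is some multiple of \<open>t\<close>.  Its planar part is that of \<open>n'\<close>, since
  \<open>v - n\<close> is vertical, and a unit vector \<open>t\<close> has nonzero planar part, so the factor is
  \<open>- \<kappa>\<close>.\<close>

lemma rotation_minimizing_normal_has_derivative:
  assumes "s \<in> I"
  shows "(v has_vector_derivative - \<kappa> s *\<^sub>R T s) (at s within I)"
proof -
  obtain c where "vderiv I v s = c *\<^sub>R T s" and "v differentiable_on I"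
    using frame assms unfolding rotation_minimizing_frame_def rotation_minimizing_def by blast
  then have v: "(v has_vector_derivative c *\<^sub>R T s) (at s within I)"
    using vderiv_works assms by metis
  have planar: "c * T s $ i = N' s $ i" if "i = 1 \<or> i = 2" for i
  proof -
    have "((\<lambda>r. v r $ i) has_vector_derivative (c *\<^sub>R T s) $ i) (at s within I)"
      by (rule bounded_linear.has_vector_derivative[OF bounded_linear_vec_nth v])
    then have *: "((\<lambda>r. N r $ i) has_vector_derivative (c *\<^sub>R T s) $ i) (at s within I)"
      by (rule has_vector_derivative_cong_on)
        (use rotation_minimizing_normal_eq that assms in auto)
    have "((\<lambda>r. N r $ i) has_vector_derivative N' s $ i) (at s within I)"
      by (rule bounded_linear.has_vector_derivative[OF bounded_linear_vec_nth
            normal_has_vderiv[OF assms]])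
    from vderiv_eqI[OF interval assms *] vderiv_eqI[OF interval assms this]
    show ?thesis by simp
  qed
  have "T s $ 1 \<noteq> 0 \<or> T s $ 2 \<noteq> 0"
    using tangent_unit[OF assms] by (auto simp: iso_inner_def)
  then have "c = - \<kappa> s"
    using planar[of 1] planar[of 2]
    unfolding normal_derivative_planar[OF assms] by (metis mult_cancel_right)
  with v show ?thesis by simp
qed

text \<open>The third coordinates of \<open>n' = - \<kappa> t + \<tau> b\<close> and \<open>v' = - \<kappa> t\<close> differ by \<open>\<tau>\<close>.\<close>

lemma frame_angle_has_derivative:
  assumes "s \<in> I"
  shows "(frame_angle has_vector_derivative iso_torsion I \<alpha> s) (at s within I)"
proof -
  have "((\<lambda>r. (N r - v r) $ 3) has_vector_derivative
      (N' s - (- \<kappa> s *\<^sub>R T s)) $ 3) (at s within I)"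
    by (intro bounded_linear.has_vector_derivative[OF bounded_linear_vec_nth]
        has_vector_derivative_diff normal_has_vderiv
        rotation_minimizing_normal_has_derivative assms)
  then show ?thesis
    by (simp add: frame_angle_def[abs_def] torsion_eq[OF assms])
qed

lemma rotation_minimizing_tangent_derivative:
  assumes "s \<in> I"
  shows "T' s = \<kappa> s *\<^sub>R v s + (\<kappa> s * frame_angle s) *\<^sub>R b s"
  using assms
  by (simp add: frenet_tangent rotation_minimizing_normal_eq binormal_const algebra_simps)

end

end

lemma frame_matrix_has_vector_derivative:
  assumes "(u has_vector_derivative u') (at s within I)"
    and "(v has_vector_derivative v') (at s within I)"
    and "(w has_vector_derivative w') (at s within I)"
  shows "((\<lambda>r. frame_matrix (u r) (v r) (w r)) has_vector_derivative frame_matrix u' v' w')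
    (at s within I)"
proof -
  have "linear (\<lambda>(u, v, w). frame_matrix u v w)"
    by (rule linearI) (auto simp: frame_matrix_def vec_eq_iff forall_3)
  then have "bounded_linear (\<lambda>(u, v, w). frame_matrix u v w)"
    by (simp add: linear_conv_bounded_linear)
  from bounded_linear.has_vector_derivative[OF this
      has_vector_derivative_Pair[OF assms(1) has_vector_derivative_Pair[OF assms(2,3)]]]
  show ?thesis by simp
qed

lemma natural_curvature_matrix_mult_frame_matrix:
  "natural_curvature_matrix k l ** frame_matrix u v w
     = frame_matrix (k *\<^sub>R v + l *\<^sub>R w) (- k *\<^sub>R u) 0"
  by (simp add: natural_curvature_matrix_def frame_matrix_def matrix_matrix_mult_def
      vec_eq_iff forall_3 sum_3)

theorem theorem5p4p1:
  fixes I :: "real set" and \<alpha> n1 n2 :: "real \<Rightarrow> real^3" and s0 :: real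
  assumes "nondegenerate_interval I"
    and "Ck_on 3 I \<alpha>"
    and "iso_admissible I \<alpha>"
    and "iso_arc_length_param I \<alpha>"
    and "rotation_minimizing_frame I \<alpha> n1 n2"
    and "s0 \<in> I"
  shows "\<exists>\<tau>0 :: real. \<exists>(\<theta> :: real \<Rightarrow> real) (\<kappa>1 :: real \<Rightarrow> real) (\<kappa>2 :: real \<Rightarrow> real).
           (\<forall>s\<in>I. \<theta> s = (LBINT x=ereal s0..ereal s. iso_torsion I \<alpha> x) + \<tau>0) \<and>
           (\<forall>s\<in>I. \<kappa>1 s = iso_curvature I \<alpha> s) \<and>
           (\<forall>s\<in>I. \<kappa>2 s = iso_curvature I \<alpha> s * \<theta> s) \<and>
           (\<forall>s\<in>I.
              ((\<lambda>r. frame_matrix (iso_tangent I \<alpha> r) (n1 r) (n2 r)) has_vector_derivative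
                 natural_curvature_matrix (\<kappa>1 s) (\<kappa>2 s)
                   ** frame_matrix (iso_tangent I \<alpha> s) (n1 s) (n2 s))
              (at s within I))"
proof -
  interpret iso_curve I \<alpha>
    by unfold_locales (fact assms)+
  note frame = \<open>rotation_minimizing_frame I \<alpha> n1 n2\<close>
  define \<theta> where "\<theta> = frame_angle n1"
  have angle: "\<theta> s = (LBINT x=ereal s0..ereal s. iso_torsion I \<alpha> x) + \<theta> s0" if "s \<in> I" for s
    using integral_torsion[OF frame_angle_has_derivative[OF frame] \<open>s0 \<in> I\<close> that]
    by (simp add: \<theta>_def)
  have derivative: "((\<lambda>r. frame_matrix (T r) (n1 r) (n2 r)) has_vector_derivative
        natural_curvature_matrix (\<kappa> s) (\<kappa> s * \<theta> s) ** frame_matrix (T s) (n1 s) (n2 s))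
      (at s within I)" if "s \<in> I" for s
  proof -
    have "((\<lambda>r. iso_binormal) has_vector_derivative 0) (at s within I)"
      by simp
    then have "(n2 has_vector_derivative 0) (at s within I)"
      by (rule has_vector_derivative_cong_on) (use binormal_const[OF frame] that in auto)
    from frame_matrix_has_vector_derivative[OF tangent_has_derivative(1)[OF that]
        rotation_minimizing_normal_has_derivative[OF frame that] this]
    show ?thesis
      unfolding natural_curvature_matrix_mult_frame_matrix
        rotation_minimizing_tangent_derivative[OF frame that] \<theta>_def .
  qed
  show ?thesis
    by (rule exI[of _ "\<theta> s0"], rule exI[of _ \<theta>], rule exI[of _ \<kappa>],
        rule exI[of _ "\<lambda>s. \<kappa> s * \<theta> s"]) (use angle derivative in blast)
qed

end
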